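(* Let $A=\{0,1,2,3\}$, let $K:A^{\mathbb{Z}^2}\to A^{\mathbb{Z}^2}$ be the language-shift cellular automaton with parameters $(P_z,P_e)$, let $3^{\infty\times\infty}\in A^{\mathbb{Z}^2}$ be the configuration all of whose cells equal $3$, and let $B(3^{\infty\times\infty})=\{x\in A^{\mathbb{Z}^2}:\lim_{n\to+\infty}K^n(x)=3^{\infty\times\infty}\}$ be its basin of attraction. (1) If $(P_z,P_e)=(2,2)$, then for every $(i,j)\in\mathbb{Z}^2$ the set $B(3^{\infty\times\infty})$ contains the cylinders $[33]_{(i,j)}$ and $\left[\begin{array}{c}3\\3\end{array}\right]_{(i,j)}$. (2) If $(P_z,P_e)=(3,3)$, then for every $(i,j)\in\mathbb{Z}^2$ the set $B(3^{\infty\times\infty})$ contains the cylinders $[333]_{(i,j)}$ and $\left[\begin{array}{c}3\\3\\3\end{array}\right]_{(i,j)}$.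
   Context: Let $A=\{0,1,2,3\}$ and let $P_z,P_e$ be integers with $0\le P_z\le 9$ and $0\le P_e\le 9$. For $x\in A^{\mathbb{Z}^2}$ and $(i,j)\in\mathbb{Z}^2$ put $$\Sigma_0(x)_{i,j}=\sum_{r=-1}^{1}\sum_{s=-1}^{1}\left\lfloor \frac{x_{(i+r,j+s)}}{2}\right\rfloor,\qquad \Sigma_1(x)_{i,j}=\sum_{r=-1}^{1}\sum_{s=-1}^{1}\left(x_{(i+r,j+s)}-2\left\lfloor \frac{x_{(i+r,j+s)}}{2}\right\rfloor\right).$$ (So $\Sigma_0$ counts the cells in state $2$ or $3$, and $\Sigma_1$ counts the cells in state $1$ or $3$, in the $3\times 3$ block centered at $(i,j)$, center included.) The language-shift cellular automaton $K$ with parameters $(P_z,P_e)$ is defined, at each $(i,j)\in\mathbb{Z}^2$, by: - if $x_{(i,j)}=0$: $K(x)_{(i,j)}=0$ if $\Sigma_0(x)_{i,j}<P_z$ and $\Sigma_1(x)_{i,j}<P_e$; $=1$ if $\Sigma_0(x)_{i,j}<P_z$ and $\Sigma_1(x)_{i,j}\ge P_e$; $=2$ if $\Sigma_0(x)_{i,j}\ge P_z$ and $\Sigma_1(x)_{i,j}<P_e$; $=3$ if $\Sigma_0(x)_{i,j}\ge P_z$ and $\Sigma_1(x)_{i,j}\ge P_e$; - if $x_{(i,j)}=1$: $K(x)_{(i,j)}=3$ if $\Sigma_0(x)_{i,j}\ge P_z$, and $=1$ otherwise; - if $x_{(i,j)}=2$: $K(x)_{(i,j)}=3$ if $\Sigma_1(x)_{i,j}\ge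 P_e$, and $=2$ otherwise; - if $x_{(i,j)}=3$: $K(x)_{(i,j)}=3$. Limits are taken in the product topology on $A^{\mathbb{Z}^2}$ ($A$ discrete), and $K^n$ is the $n$-fold iterate of $K$. A pattern $w\in A^{n\times m}$ has size $|w|=(|w|_1,|w|_2)=(n,m)$, where the first coordinate is horizontal and the second vertical; the cylinder $[w]_{(i,j)}$ is the set of $x\in A^{\mathbb{Z}^2}$ whose restriction to $[i,i+|w|_1)\times[j,j+|w|_2)$ equals $w$. Thus $[33]_{(i,j)}=\{x: x_{(i,j)}=x_{(i+1,j)}=3\}$, $[333]_{(i,j)}=\{x: x_{(i,j)}=x_{(i+1,j)}=x_{(i+2,j)}=3\}$, and the column patterns are given by the same conditions along the vertical direction, i.e. $x_{(i,j)}=x_{(i,j+1)}=3$ and $x_{(i,j)}=x_{(i,j+1)}=x_{(i,j+2)}=3$ respectively. *)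

theory Defs
  imports "HOL-Analysis.Function_Topology" "HOL-Analysis.Abstract_Limits"
begin

definition alphabet :: "nat set" where
  "alphabet = {0, 1, 2, 3}"

type_synonym config = "int \<times> int \<Rightarrow> nat"

text \<open>The full shift: cells range over \<open>\<int> \<times> \<int>\<close> (horizontal coordinate first) and states
  over the alphabet. All notions below are relative to this set of configurations.\<close>

definition configs :: "config set" where
  "configs = (UNIV \<rightarrow>\<^sub>E alphabet)"

definition config_topology :: "config topology" where
  "config_topology = product_topology (\<lambda>_. discrete_topology alphabet) UNIV"

lemma topspace_config_topology: "topspace config_topology = configs"
  by (simp add: config_topology_def configs_def)

definition Sigma0 :: "config \<Rightarrow> int \<Rightarrow> int \<Rightarrow> nat" where
  "Sigma0 x i j = (\<Sum>r\<in>{-1..1}. \<Sum>s\<in>{-1..1}. x (i + r, j + s) div 2)"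

text \<open>The subtraction never truncates.\<close>

definition Sigma1 :: "config \<Rightarrow> int \<Rightarrow> int \<Rightarrow> nat" where
  "Sigma1 x i j =
    (\<Sum>r\<in>{-1..1}. \<Sum>s\<in>{-1..1}. x (i + r, j + s) - 2 * (x (i + r, j + s) div 2))"

text \<open>The last branch is the case of state \<open>3\<close>; its value at states outside the alphabet is
  irrelevant, as only elements of \<open>configs\<close> are considered.\<close>

definition language_shift :: "nat \<Rightarrow> nat \<Rightarrow> config \<Rightarrow> config" where
  "language_shift Pz Pe x = (\<lambda>(i, j).
    if x (i, j) = 0 then
      (if Sigma0 x i j < Pz \<and> Sigma1 x i j < Pe then 0
       else if Sigma0 x i j < Pz \<and> Sigma1 x i j \<ge> Pe then 1
       else if Sigma0 x i j \<ge> Pz \<and> Sigma1 x i j < Pe then 2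
       else 3)
    else if x (i, j) = 1 then (if Sigma0 x i j \<ge> Pz then 3 else 1)
    else if x (i, j) = 2 then (if Sigma1 x i j \<ge> Pe then 3 else 2)
    else 3)"

lemma language_shift_in_configs: "language_shift Pz Pe x \<in> configs"
  by (simp add: language_shift_def configs_def alphabet_def PiE_UNIV_domain Pi_iff)

definition all_threes :: config where
  "all_threes = (\<lambda>_. 3)"

definition basin :: "(config \<Rightarrow> config) \<Rightarrow> config \<Rightarrow> config set" where
  "basin F c = {x \<in> configs. limitin config_topology (\<lambda>n. (F ^^ n) x) c sequentially}"

text \<open>A pattern of size \<open>(n, m)\<close> is given by its entries \<open>w (k, l)\<close> for \<open>k < n\<close> and \<open>l < m\<close>, with
  \<open>k\<close> horizontal and \<open>l\<close> vertical; other values of \<open>w\<close> play no role.\<close>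

definition cylinder :: "nat \<times> nat \<Rightarrow> (nat \<times> nat \<Rightarrow> nat) \<Rightarrow> int \<times> int \<Rightarrow> config set" where
  "cylinder = (\<lambda>(n, m) w (i, j).
    {x \<in> configs. \<forall>k<n. \<forall>l<m. x (i + int k, j + int l) = w (k, l)})"

end

theory Submission
  imports Defs
begin

text \<open>State 3 is permanent, so finitely many cells that are eventually in state 3 are so at a common
  time. Hence the set of cells that are eventually in state 3 is closed under threshold growth: if it
  contains \<open>\<theta> \<ge> P\<^sub>z, P\<^sub>e\<close> cells of the block around a cell, then it contains that cell. For
  \<open>\<theta> = 3\<close> a closed set containing a horizontal triple contains its four unit translates, and
  therefore the whole plane.\<close>

section \<open>Counting threes in a block\<close>

definition nbhd :: "int \<times> int \<Rightarrow> (int \<times> int) set" where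
  "nbhd v = {fst v - 1..fst v + 1} \<times> {snd v - 1..snd v + 1}"

lemma finite_nbhd: "finite (nbhd v)"
  by (simp add: nbhd_def)

lemma sum_block_eq_sum_nbhd:
  fixes g :: "int \<times> int \<Rightarrow> nat"
  shows "(\<Sum>r\<in>{-1..1}. \<Sum>s\<in>{-1..1}. g (i + r, j + s)) = sum g (nbhd (i, j))"
proof -
  have "(\<Sum>r\<in>{-1..1}. \<Sum>s\<in>{-1..1}. g (i + r, j + s))
      = (\<Sum>(r, s)\<in>{-1..1} \<times> {-1..1}. g (i + r, j + s))"
    by (simp add: sum.cartesian_product)
  also have "\<dots> = sum g (nbhd (i, j))"
    by (rule sum.reindex_bij_witness[of _ "\<lambda>(a, b). (a - i, b - j)" "\<lambda>(r, s). (i + r, j + s)"])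
      (auto simp: nbhd_def)
  finally show ?thesis .
qed

text \<open>Since \<open>3 div 2 = 1\<close> and \<open>3 - 2 * 1 = 1\<close>, a cell in state 3
  contributes exactly 1 to both sums, while no other cell of the block contributes
  negatively.\<close>

lemma card_threes_le_Sigma:
  assumes "T \<subseteq> nbhd (i, j)" and "\<And>u. u \<in> T \<Longrightarrow> x u = 3"
  shows "card T \<le> Sigma0 x i j" and "card T \<le> Sigma1 x i j"
proof -
  have le: "card T \<le> sum g (nbhd (i, j))" if "\<And>u. u \<in> T \<Longrightarrow> g u = 1" for g :: "int \<times> int \<Rightarrow> nat"
  proof -
    have "card T = sum g T"
      using that by simp
    also have "\<dots> \<le> sum g (nbhd (i, j))"
      using assms(1) by (intro sum_mono2 finite_nbhd) auto
    finally show ?thesis .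
  qed
  show "card T \<le> Sigma0 x i j"
    unfolding Sigma0_def sum_block_eq_sum_nbhd[of "\<lambda>u. x u div 2"]
    by (rule le) (simp add: assms(2))
  show "card T \<le> Sigma1 x i j"
    unfolding Sigma1_def sum_block_eq_sum_nbhd[of "\<lambda>u. x u - 2 * (x u div 2)"]
    by (rule le) (simp add: assms(2))
qed

text \<open>Once both sums reach their thresholds, every branch of the rule returns 3, so the
  current state of \<open>v\<close> does not matter.\<close>

lemma language_shift_eq_3:
  assumes "T \<subseteq> nbhd v" and "\<And>u. u \<in> T \<Longrightarrow> x u = 3" and "Pz \<le> card T" and "Pe \<le> card T"
  shows "language_shift Pz Pe x v = 3"
proof -
  obtain i j where v: "v = (i, j)"
    by (cases v)
  have "Pz \<le> Sigma0 x i j" "Pe \<le> Sigma1 x i j"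
    using card_threes_le_Sigma[of T i j x] assms v by auto
  then show ?thesis
    by (simp add: language_shift_def v)
qed

lemma language_shift_3: "x v = 3 \<Longrightarrow> language_shift Pz Pe x v = 3"
  by (cases v) (simp add: language_shift_def)

section \<open>Cells eventually in state 3, and the basin\<close>

definition eventual_threes :: "(config \<Rightarrow> config) \<Rightarrow> config \<Rightarrow> (int \<times> int) set" where
  "eventual_threes F x = {v. \<forall>\<^sub>F n in sequentially. (F ^^ n) x v = 3}"

lemma initial_three_in_eventual_threes:
  assumes "x v = 3"
  shows "v \<in> eventual_threes (language_shift Pz Pe) x"
proof -
  have "(language_shift Pz Pe ^^ n) x v = 3" for n
    by (induction n) (simp_all add: assms language_shift_3)
  then show ?thesis
    by (simp add: eventual_threes_def)
qed

text \<open>The witness set \<open>T\<close> lets applications exhibit just enough explicit cells.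
  As \<open>nbhd v\<close> is finite, the premise amounts to
  \<open>\<theta> \<le> card (E \<inter> nbhd v)\<close>.\<close>

definition threshold_closed :: "nat \<Rightarrow> (int \<times> int) set \<Rightarrow> bool" where
  "threshold_closed \<theta> E \<longleftrightarrow> (\<forall>v T. T \<subseteq> E \<inter> nbhd v \<longrightarrow> \<theta> \<le> card T \<longrightarrow> v \<in> E)"

lemma threshold_closed_mono: "threshold_closed \<theta> E \<Longrightarrow> \<theta> \<le> \<theta>' \<Longrightarrow> threshold_closed \<theta>' E"
  unfolding threshold_closed_def by (meson order_trans)

lemma threshold_closed_eventual_threes:
  assumes "Pz \<le> \<theta>" and "Pe \<le> \<theta>"
  shows "threshold_closed \<theta> (eventual_threes (language_shift Pz Pe) x)"
  unfolding threshold_closed_def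
proof (intro allI impI)
  let ?F = "language_shift Pz Pe"
  fix v T
  assume T: "T \<subseteq> eventual_threes ?F x \<inter> nbhd v" and card: "\<theta> \<le> card T"
  have "finite T"
    using T finite_nbhd finite_subset by blast
  \<comment> \<open>Finiteness of \<open>T\<close> allows the quantifier over its cells to move
    inside the eventual one.\<close>
  then have "\<forall>\<^sub>F n in sequentially. \<forall>u\<in>T. (?F ^^ n) x u = 3"
    using T by (auto simp: eventually_ball_finite_distrib eventual_threes_def)
  then have "\<forall>\<^sub>F n in sequentially. (?F ^^ Suc n) x v = 3"
  proof eventually_elim
    case (elim n)
    show ?case
      unfolding funpow.simps comp_apply
      by (rule language_shift_eq_3[of T]) (use T card assms elim in auto)
  qed
  then show "v \<in> eventual_threes ?F x"
    unfolding eventual_threes_def mem_Collect_eq by (subst (asm) eventually_sequentially_Suc)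
qed

text \<open>Convergence in the product topology is coordinatewise, and in a discrete factor an
  eventually constant sequence converges to its eventual value.\<close>

lemma in_basin_all_threesI:
  assumes "x \<in> configs" and "eventual_threes F x = UNIV" and "\<And>y. F y \<in> configs"
  shows "x \<in> basin F all_threes"
proof -
  have "(F ^^ n) x \<in> configs" for n
    by (cases n) (simp_all add: assms)
  then have orbit: "(F ^^ n) x v \<in> alphabet" for n v
    by (auto simp: configs_def)
  have "limitin (discrete_topology alphabet) (\<lambda>n. (F ^^ n) x v) 3 sequentially" for v
  proof -
    have "\<forall>\<^sub>F n in sequentially. (F ^^ n) x v = 3"
      using assms(2) unfolding eventual_threes_def by blast
    then show ?thesis
      by (intro limitin_eventually) (simp_all add: alphabet_def)
  qed
  then have "limitin config_topology (\<lambda>n. (F ^^ n) x) all_threes sequentially"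
    unfolding config_topology_def limitin_componentwise
    using orbit by (simp add: all_threes_def PiE_UNIV_domain)
  then show ?thesis
    using assms(1) by (simp add: basin_def)
qed

section \<open>Growth of closed sets to the whole plane\<close>

lemma threshold_closed_2D:
  assumes "threshold_closed 2 E" and "a \<in> E" "b \<in> E" and "a \<in> nbhd v" "b \<in> nbhd v" and "a \<noteq> b"
  shows "v \<in> E"
proof -
  have "{a, b} \<subseteq> E \<inter> nbhd v" "2 \<le> card {a, b}"
    using assms by auto
  then show ?thesis
    using assms(1) unfolding threshold_closed_def by blast
qed

lemma threshold_closed_3D:
  assumes "threshold_closed 3 E" and "a \<in> E" "b \<in> E" "c \<in> E"
    and "a \<in> nbhd v" "b \<in> nbhd v" "c \<in> nbhd v" and "a \<noteq> b" "a \<noteq> c" "b \<noteq> c"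
  shows "v \<in> E"
proof -
  have "{a, b, c} \<subseteq> E \<inter> nbhd v" "3 \<le> card {a, b, c}"
    using assms by auto
  then show ?thesis
    using assms(1) unfolding threshold_closed_def by blast
qed

definition triple_row :: "int \<Rightarrow> int \<Rightarrow> (int \<times> int) set" where
  "triple_row i j = {(i - 1, j), (i, j), (i + 1, j)}"

text \<open>The middle cell of the new row has all three old cells in its block. Each outer cell has
  only two of them, so it needs the new middle cell as its third.\<close>

lemma triple_row_vertical_step:
  assumes E: "threshold_closed 3 E" and row: "triple_row i j \<subseteq> E" and d: "\<bar>d\<bar> = 1"
  shows "triple_row i (j + d) \<subseteq> E"
proof -
  have r: "(i - 1, j) \<in> E" "(i, j) \<in> E" "(i + 1, j) \<in> E"
    using row by (auto simp: triple_row_def)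
  have m: "(i, j + d) \<in> E"
    by (rule threshold_closed_3D[OF E r]) (use d in \<open>auto simp: nbhd_def\<close>)
  have "(i - 1, j + d) \<in> E"
    by (rule threshold_closed_3D[OF E r(1,2) m]) (use d in \<open>auto simp: nbhd_def\<close>)
  moreover have "(i + 1, j + d) \<in> E"
    by (rule threshold_closed_3D[OF E r(2,3) m]) (use d in \<open>auto simp: nbhd_def\<close>)
  ultimately show ?thesis
    using m by (simp add: triple_row_def)
qed

text \<open>The cell \<open>(i + 2 * d, j)\<close> sees only one cell of the row. The rows above and
  below, obtained by vertical steps, supply the other two cells of the adjacent column.\<close>

lemma triple_row_horizontal_step:
  assumes E: "threshold_closed 3 E" and row: "triple_row i j \<subseteq> E" and d: "\<bar>d\<bar> = 1"
  shows "triple_row (i + d) j \<subseteq> E"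
proof -
  have d': "d = 1 \<or> d = -1"
    using d by linarith
  have "triple_row i (j + 1) \<subseteq> E" "triple_row i (j + (- 1)) \<subseteq> E"
    by (rule triple_row_vertical_step[OF E row]; simp)+
  then have r: "(i + d, j) \<in> E" "(i + d, j + 1) \<in> E" "(i + d, j - 1) \<in> E"
    using row d' by (auto simp: triple_row_def)
  have "(i + 2 * d, j) \<in> E"
    by (rule threshold_closed_3D[OF E r]) (use d in \<open>auto simp: nbhd_def\<close>)
  then show ?thesis
    using row d' by (auto simp: triple_row_def algebra_simps)
qed

text \<open>Slide the triple along row \<open>j\<close> in both directions, then move every
  translate up and down.\<close>

lemma triple_row_imp_UNIV:
  assumes E: "threshold_closed 3 E" and row: "triple_row i j \<subseteq> E"
  shows "E = UNIV"
proof -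
  have h: "triple_row k j \<subseteq> E" for k
  proof (induction k rule: int_induct[of _ i])
    case base
    show ?case by (rule row)
  next
    case (step1 k)
    then show ?case using triple_row_horizontal_step[OF E, of k j 1] by simp
  next
    case (step2 k)
    then show ?case using triple_row_horizontal_step[OF E, of k j "-1"] by simp
  qed
  have "triple_row k l \<subseteq> E" for k l
  proof (induction l rule: int_induct[of _ j])
    case base
    show ?case by (rule h)
  next
    case (step1 l)
    then show ?case using triple_row_vertical_step[OF E, of k l 1] by simp
  next
    case (step2 l)
    then show ?case using triple_row_vertical_step[OF E, of k l "-1"] by simp
  qed
  then show ?thesis
    by (auto simp: triple_row_def)
qed

text \<open>The blocks around the left and right neighbours of the middle cell contain the whole
  column, which produces a horizontal triple centred at \<open>(i, j + 1)\<close>.\<close>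

lemma triple_column_imp_UNIV:
  assumes E: "threshold_closed 3 E" and c: "(i, j) \<in> E" "(i, j + 1) \<in> E" "(i, j + 2) \<in> E"
  shows "E = UNIV"
proof -
  have "(i - 1, j + 1) \<in> E" "(i + 1, j + 1) \<in> E"
    by (rule threshold_closed_3D[OF E c]; simp add: nbhd_def)+
  then have "triple_row i (j + 1) \<subseteq> E"
    using c by (simp add: triple_row_def)
  then show ?thesis
    by (rule triple_row_imp_UNIV[OF E])
qed

text \<open>The cell \<open>(i - 1, j)\<close> sees only one cell of the pair, so
  \<open>(i, j + 1)\<close> is filled first as its second neighbour. This gives a horizontal triple,
  and closure at threshold 2 implies closure at threshold 3.\<close>

lemma pair_row_imp_UNIV:
  assumes E: "threshold_closed 2 E" and p: "(i, j) \<in> E" "(i + 1, j) \<in> E"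
  shows "E = UNIV"
proof -
  have q: "(i, j + 1) \<in> E"
    by (rule threshold_closed_2D[OF E p]) (simp_all add: nbhd_def)
  have "(i - 1, j) \<in> E"
    by (rule threshold_closed_2D[OF E p(1) q]) (simp_all add: nbhd_def)
  then have "triple_row i j \<subseteq> E"
    using p by (simp add: triple_row_def)
  then show ?thesis
    by (rule triple_row_imp_UNIV[OF threshold_closed_mono[OF E], rotated]) simp
qed

text \<open>The right neighbour of the lower cell sees both cells of the column, and with the lower
  cell it forms a horizontal pair.\<close>

lemma pair_column_imp_UNIV:
  assumes E: "threshold_closed 2 E" and p: "(i, j) \<in> E" "(i, j + 1) \<in> E"
  shows "E = UNIV"
proof -
  have "(i + 1, j) \<in> E"
    by (rule threshold_closed_2D[OF E p]) (simp_all add: nbhd_def)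
  then show ?thesis
    using pair_row_imp_UNIV[OF E p(1)] by simp
qed

theorem proposition9:
  fixes Pz Pe :: nat
  assumes "Pz \<le> 9" and "Pe \<le> 9"
  shows "((Pz, Pe) = (2, 2) \<longrightarrow>
            (\<forall>i j. cylinder (2, 1) (\<lambda>_. 3) (i, j) \<subseteq> basin (language_shift Pz Pe) all_threes \<and>
                   cylinder (1, 2) (\<lambda>_. 3) (i, j) \<subseteq> basin (language_shift Pz Pe) all_threes)) \<and>
         ((Pz, Pe) = (3, 3) \<longrightarrow>
            (\<forall>i j. cylinder (3, 1) (\<lambda>_. 3) (i, j) \<subseteq> basin (language_shift Pz Pe) all_threes \<and>
                   cylinder (1, 3) (\<lambda>_. 3) (i, j) \<subseteq> basin (language_shift Pz Pe) all_threes))"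
proof (intro conjI impI allI subsetI)
  fix i j x
  let ?E = "eventual_threes (language_shift Pz Pe) x"
  note I = in_basin_all_threesI[OF _ _ language_shift_in_configs]
  note init = initial_three_in_eventual_threes
  {
    assume P: "(Pz, Pe) = (2, 2)"
    then have E: "threshold_closed 2 ?E"
      by (intro threshold_closed_eventual_threes) auto
    {
      assume "x \<in> cylinder (2, 1) (\<lambda>_. 3) (i, j)"
      then have x: "x \<in> configs" "\<And>k. k < 2 \<Longrightarrow> x (i + int k, j) = 3"
        by (auto simp: cylinder_def)
      then have "?E = UNIV"
        using x(2)[of 0] x(2)[of 1] by (intro pair_row_imp_UNIV[OF E, of i j] init) auto
      with x(1) show "x \<in> basin (language_shift Pz Pe) all_threes"
        by (rule I)
    next
      assume "x \<in> cylinder (1, 2) (\<lambda>_. 3) (i, j)"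
      then have x: "x \<in> configs" "\<And>k. k < 2 \<Longrightarrow> x (i, j + int k) = 3"
        by (auto simp: cylinder_def)
      then have "?E = UNIV"
        using x(2)[of 0] x(2)[of 1] by (intro pair_column_imp_UNIV[OF E, of i j] init) auto
      with x(1) show "x \<in> basin (language_shift Pz Pe) all_threes"
        by (rule I)
    }
  next
    assume P: "(Pz, Pe) = (3, 3)"
    then have E: "threshold_closed 3 ?E"
      by (intro threshold_closed_eventual_threes) auto
    {
      assume "x \<in> cylinder (3, 1) (\<lambda>_. 3) (i, j)"
      then have x: "x \<in> configs" "\<And>k. k < 3 \<Longrightarrow> x (i + int k, j) = 3"
        by (auto simp: cylinder_def)
      \<comment> \<open>The cylinder is indexed by its leftmost cell but \<open>triple_row\<close>
        by its centre, hence the shift by 1.\<close>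
      have "triple_row (i + 1) j \<subseteq> ?E"
        using x(2)[of 0] x(2)[of 1] x(2)[of 2] by (auto simp: triple_row_def add.assoc intro!: init)
      then have "?E = UNIV"
        by (rule triple_row_imp_UNIV[OF E])
      with x(1) show "x \<in> basin (language_shift Pz Pe) all_threes"
        by (rule I)
    next
      assume "x \<in> cylinder (1, 3) (\<lambda>_. 3) (i, j)"
      then have x: "x \<in> configs" "\<And>k. k < 3 \<Longrightarrow> x (i, j + int k) = 3"
        by (auto simp: cylinder_def)
      then have "?E = UNIV"
        using x(2)[of 0] x(2)[of 1] x(2)[of 2]
        by (intro triple_column_imp_UNIV[OF E, of i j] init) auto
      with x(1) show "x \<in> basin (language_shift Pz Pe) all_threes"
        by (rule I)
    }
  }
qed

end
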